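(* Let $k\ge 1$ be an integer and let $n\ge 8$ and $s$ be positive integers with $s^2\equiv 1 \pmod n$ and $s\not\equiv \pm 1 \pmod n$. Suppose that $n=2n_1n_2$, where $n_1,n_2$ are coprime positive integers with $s\equiv -1 \pmod{n_1}$ and $s\equiv 1\pmod{n_2}$, and where either $n_1,n_2\ge 3$, or $n=2^t$ for some $t\ge 3$ and $(n_1,n_2)\in\{(1,2^{t-1}),(2^{t-1},1)\}$. Then $$\mathsf D_{\{1,s\}}(C_n^k)\ \ge\ k\cdot \mathsf D_{\{1,s\}}(C_{n_1n_2})+1.$$
   Context: $C_m$ denotes the cyclic group of order $m$, written additively, and $C_m^k$ the direct sum of $k$ copies of it. A sequence over a finite abelian group $G$ is a finite unordered list of elements of $G$ with repetition allowed; its length is the number of terms counted with multiplicity. For a finite abelian group $G$ and a non-empty set $A\subset\mathbb Z$ containing no multiple of the exponent of $G$, the $A$-weighted Davenport constant $\mathsf D_A(G)$ is the smallest positive integer $D$ such that every sequence of length $D$ over $G$ has a non-empty subsequence $x_1,\dots,x_t$ with $\varepsilon_1x_1+\dots+\varepsilon_tx_t=0$ for some $\varepsilon_1,\dots,\varepsilon_t\in A$. *)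

theory Defs
  imports "HOL-Algebra.Product_Groups" "HOL-Algebra.FiniteProduct" "HOL-Number_Theory.Cong" "HOL-Library.Multiset"
begin

text \<open>
  Groups are written multiplicatively, as usual in HOL-Algebra, so the weighted sum
  \<open>\<epsilon>\<^sub>1 x\<^sub>1 + \<dots> + \<epsilon>\<^sub>t x\<^sub>t\<close> is a product of integer powers and \<open>0\<close> is the neutral element.
  Sequences over a group are unordered, hence multisets; the lists \<open>xs\<close> and \<open>es\<close> enumerate
  the terms of a subsequence and the weights attached to them, so that different
  occurrences of the same element may receive different weights.
\<close>

definition has_weighted_zero_sum :: "('a, 'b) monoid_scheme \<Rightarrow> int set \<Rightarrow> 'a multiset \<Rightarrow> bool" where
  "has_weighted_zero_sum G A S \<longleftrightarrow>
     (\<exists>xs es. xs \<noteq> [] \<and> mset xs \<subseteq># S \<and> length es = length xs \<and> set es \<subseteq> A \<and>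
        (\<Otimes>\<^bsub>G\<^esub>i\<in>{..<length xs}. (xs ! i) [^]\<^bsub>G\<^esub> (es ! i)) = \<one>\<^bsub>G\<^esub>)"

text \<open>
  For a finite abelian group \<open>G\<close> and non-empty \<open>A\<close> the minimum below is attained:
  \<open>D = order G\<close> has the required property, already with a single constant weight.
\<close>

definition weighted_davenport :: "int set \<Rightarrow> ('a, 'b) monoid_scheme \<Rightarrow> nat" where
  "weighted_davenport A G =
     (LEAST D. 0 < D \<and>
        (\<forall>S. set_mset S \<subseteq> carrier G \<and> size S = D \<longrightarrow> has_weighted_zero_sum G A S))"

abbreviation cyclic_power :: "nat \<Rightarrow> nat \<Rightarrow> (nat \<Rightarrow> int) monoid" where
  "cyclic_power m k \<equiv> product_group {..<k} (\<lambda>_. integer_mod_group m)"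

end

theory Submission
  imports Defs "HOL-Algebra.Multiplicative_Group"
begin

text \<open>
  Both weights are odd: so is \<open>s\<close>, because \<open>s\<^sup>2 \<equiv> 1\<close> modulo the even number \<open>n\<close>.  Hence, with
  \<open>m = n\<^sub>1 n\<^sub>2\<close> and \<open>n = 2 m\<close>, a weighted sum over \<open>C\<^sub>n\<close> of a sequence with exactly one odd term can
  vanish only if the odd term is left out.  Take a longest sequence \<open>T\<close> over \<open>C\<^sub>m\<close> without
  weighted zero-sum subsequence, embed it into \<open>C\<^sub>n\<close> by doubling, and add the term \<open>1\<close>: the
  result still has no weighted zero-sum subsequence, so \<open>D(C\<^sub>n) \<ge> D(C\<^sub>m) + 1\<close>.  Placing a copy of
  this sequence in each of the \<open>k\<close> coordinates of \<open>C\<^sub>n\<^sup>k\<close> multiplies the length by \<open>k\<close>.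

  Both steps are instances of one fact about group extensions, \<open>weighted_davenport_extension\<close>:
  if \<open>K\<close> embeds into the kernel of a surjection \<open>G \<rightarrow> H\<close>, then \<open>D(G) + 1 \<ge> D(K) + D(H)\<close>.  It is
  used for \<open>C\<^sub>m \<rightarrow> C\<^sub>2\<^sub>m \<rightarrow> C\<^sub>2\<close>, where \<open>D(C\<^sub>2) \<ge> 2\<close> for odd weights, and, inductively, for
  \<open>C\<^sub>n\<^sup>k \<rightarrow> C\<^sub>n\<^sup>k\<^sup>+\<^sup>1 \<rightarrow> C\<^sub>n\<close>.
\<close>

section \<open>Weighted products along lists\<close>

text \<open>
  Dropping trivial terms from an indexed product over \<open>{..<length xs}\<close> would renumber all
  later terms.  Storing each term together with its weight in one list turns this into
  \<^const>\<open>filter\<close>.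
\<close>

primrec weighted_prod :: "('a, 'b) monoid_scheme \<Rightarrow> ('a \<times> int) list \<Rightarrow> 'a" where
  "weighted_prod G [] = \<one>\<^bsub>G\<^esub>"
| "weighted_prod G (q # qs) = fst q [^]\<^bsub>G\<^esub> snd q \<otimes>\<^bsub>G\<^esub> weighted_prod G qs"

lemma (in group) weighted_prod_closed [simp]:
  "fst ` set qs \<subseteq> carrier G \<Longrightarrow> weighted_prod G qs \<in> carrier G"
  by (induction qs) auto

lemma (in group) weighted_prod_append:
  assumes "fst ` set qs \<subseteq> carrier G" "fst ` set rs \<subseteq> carrier G"
  shows "weighted_prod G (qs @ rs) = weighted_prod G qs \<otimes> weighted_prod G rs"
  using assms by (induction qs) (auto simp: m_assoc)

lemma (in comm_group) finprod_eq_weighted_prod: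
  assumes "fst ` set qs \<subseteq> carrier G"
  shows "(\<Otimes>i\<in>{..<length qs}. fst (qs ! i) [^] snd (qs ! i)) = weighted_prod G qs"
  using assms
proof (induction qs rule: rev_induct)
  case (snoc q qs)
  have "(\<Otimes>i\<in>{..<length qs}. fst ((qs @ [q]) ! i) [^] snd ((qs @ [q]) ! i))
      = (\<Otimes>i\<in>{..<length qs}. fst (qs ! i) [^] snd (qs ! i))"
    using snoc.prems by (intro finprod_cong') (auto simp: nth_append image_subset_iff)
  moreover have "fst ((qs @ [q]) ! i) [^] snd ((qs @ [q]) ! i) \<in> carrier G"
    if "i < length qs" for i
    using snoc.prems that by (auto simp: nth_append image_subset_iff)
  ultimately show ?case
    using snoc by (simp add: lessThan_Suc weighted_prod_append Pi_iff m_comm)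
qed simp

lemma weighted_prod_hom:
  assumes "group G" "group H" "h \<in> hom G H" "fst ` set qs \<subseteq> carrier G"
  shows "h (weighted_prod G qs) = weighted_prod H (map (map_prod h id) qs)"
  using assms(4)
proof (induction qs)
  case Nil
  then show ?case using hom_one[OF assms(3,1,2)] by simp
next
  case (Cons q qs)
  then show ?case
    using assms(1-3)
    by (simp add: hom_mult[OF assms(3)] hom_int_pow group.int_pow_closed group.weighted_prod_closed)
qed

lemma (in group) weighted_prod_filter:
  assumes "fst ` set qs \<subseteq> carrier G" "\<And>q. q \<in> set qs \<Longrightarrow> \<not> P q \<Longrightarrow> fst q = \<one>"
  shows "weighted_prod G (filter P qs) = weighted_prod G qs"
  using assms by (induction qs) (auto simp: image_subset_iff)

lemma has_weighted_zero_sum_iff: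
  assumes "comm_group G" "set_mset S \<subseteq> carrier G"
  shows "has_weighted_zero_sum G A S \<longleftrightarrow>
    (\<exists>qs. qs \<noteq> [] \<and> mset (map fst qs) \<subseteq># S \<and> snd ` set qs \<subseteq> A \<and> weighted_prod G qs = \<one>\<^bsub>G\<^esub>)"
    (is "_ \<longleftrightarrow> (\<exists>qs. ?zs qs)")
proof
  interpret comm_group G by fact
  have carr: "set xs \<subseteq> carrier G" if "mset xs \<subseteq># S" for xs
    using set_mset_mono[OF that] assms(2) by auto
  {
    assume "has_weighted_zero_sum G A S"
    then obtain xs es where *: "xs \<noteq> []" "mset xs \<subseteq># S" "length es = length xs" "set es \<subseteq> A"
      "(\<Otimes>\<^bsub>G\<^esub>i\<in>{..<length xs}. (xs ! i) [^]\<^bsub>G\<^esub> (es ! i)) = \<one>\<^bsub>G\<^esub>"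
      unfolding has_weighted_zero_sum_def by blast
    have maps: "map fst (zip xs es) = xs" "map snd (zip xs es) = es"
      using *(3) by simp_all
    have sets: "fst ` set (zip xs es) = set xs" "snd ` set (zip xs es) = set es"
      by (metis maps set_map)+
    have "weighted_prod G (zip xs es)
        = (\<Otimes>\<^bsub>G\<^esub>i\<in>{..<length (zip xs es)}. fst (zip xs es ! i) [^]\<^bsub>G\<^esub> snd (zip xs es ! i))"
      using carr[OF *(2)] sets by (intro finprod_eq_weighted_prod[symmetric]) simp
    also have "\<dots> = (\<Otimes>\<^bsub>G\<^esub>i\<in>{..<length xs}. (xs ! i) [^]\<^bsub>G\<^esub> (es ! i))"
      using *(3) carr[OF *(2)] by (intro finprod_cong') (auto simp: subset_iff)
    finally have "?zs (zip xs es)"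
      using * maps sets by (auto simp: zip_eq_Nil_iff)
    then show "\<exists>qs. ?zs qs" by blast
  next
    assume "\<exists>qs. ?zs qs"
    then obtain qs where *: "?zs qs" by blast
    have c: "fst ` set qs \<subseteq> carrier G"
      using carr[of "map fst qs"] * by simp
    have "(\<Otimes>\<^bsub>G\<^esub>i\<in>{..<length (map fst qs)}. (map fst qs ! i) [^]\<^bsub>G\<^esub> (map snd qs ! i))
        = (\<Otimes>\<^bsub>G\<^esub>i\<in>{..<length qs}. fst (qs ! i) [^]\<^bsub>G\<^esub> snd (qs ! i))"
      using c by (intro finprod_cong') (auto simp: image_subset_iff)
    also have "\<dots> = \<one>\<^bsub>G\<^esub>"
      using * finprod_eq_weighted_prod[OF c] by simp
    finally show "has_weighted_zero_sum G A S"
      unfolding has_weighted_zero_sum_def using *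
      by (intro exI[of _ "map fst qs"] exI[of _ "map snd qs"]) auto
  }
qed

section \<open>The weighted Davenport constant as a maximum\<close>

lemma has_weighted_zero_sum_mono:
  "has_weighted_zero_sum G A S \<Longrightarrow> S \<subseteq># T \<Longrightarrow> has_weighted_zero_sum G A T"
  unfolding has_weighted_zero_sum_def by (meson subset_mset.order_trans)

text \<open>
  In a sequence of length \<open>N\<^sup>2\<close>, where \<open>N\<close> is the order of the group, some element occurs at
  least \<open>N\<close> times, and \<open>N\<close> copies of one element with a constant weight multiply to \<open>\<one>\<close>.  The
  bound is crude, but it makes the least number in the definition exist.
\<close>

lemma has_weighted_zero_sum_of_large_size:
  assumes "comm_group G" "finite (carrier G)" "a \<in> A"
    and S: "set_mset S \<subseteq> carrier G" "size S = order G * order G"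
  shows "has_weighted_zero_sum G A S"
proof -
  interpret comm_group G by fact
  let ?N = "order G"
  have N: "?N > 0" using assms(2) order_gt_0_iff_finite by blast
  have "\<exists>x. count S x \<ge> ?N"
  proof (rule ccontr)
    assume "\<not> ?thesis"
    then have less: "count S x \<le> ?N - 1" for x
      using N by (metis Suc_pred' less_Suc_eq_le not_le)
    have "size S \<le> (\<Sum>x\<in>set_mset S. ?N - 1)"
      unfolding size_multiset_overloaded_eq by (intro sum_mono less)
    also have "\<dots> \<le> ?N * (?N - 1)"
      using card_mono[OF assms(2) S(1)] by (simp add: order_def)
    also have "\<dots> < ?N * ?N" using N by simp
    finally show False using S(2) by simp
  qed
  then obtain x where x: "count S x \<ge> ?N" ..
  then have xS: "x \<in> carrier G"
    using N S(1) by (metis count_inI le_zero_eq not_gr_zero subset_iff)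
  have "(\<Otimes>\<^bsub>G\<^esub>i\<in>{..<length (replicate ?N x)}. (replicate ?N x ! i) [^]\<^bsub>G\<^esub> (replicate ?N a ! i))
      = (\<Otimes>\<^bsub>G\<^esub>i\<in>{..<?N}. x [^]\<^bsub>G\<^esub> a)"
    using xS by (intro finprod_cong') auto
  also have "\<dots> = (x [^]\<^bsub>G\<^esub> a) [^]\<^bsub>G\<^esub> ?N"
    using xS by (simp add: finprod_const)
  also have "\<dots> = \<one>\<^bsub>G\<^esub>"
    using xS by (simp add: pow_order_eq_1)
  finally show ?thesis
    unfolding has_weighted_zero_sum_def using N x assms(3)
    by (intro exI[of _ "replicate ?N x"] exI[of _ "replicate ?N a"])
       (auto simp: count_le_replicate_mset_subset_eq)
qed

lemma weighted_davenport_property: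
  assumes "comm_group G" "finite (carrier G)" "A \<noteq> {}"
  shows "0 < weighted_davenport A G"
    and "\<lbrakk>set_mset S \<subseteq> carrier G; size S = weighted_davenport A G\<rbrakk> \<Longrightarrow> has_weighted_zero_sum G A S"
proof -
  interpret comm_group G by fact
  obtain a where "a \<in> A" using assms(3) by blast
  then have "0 < order G * order G \<and>
      (\<forall>S. set_mset S \<subseteq> carrier G \<and> size S = order G * order G \<longrightarrow> has_weighted_zero_sum G A S)"
    using assms(1,2) has_weighted_zero_sum_of_large_size order_gt_0_iff_finite by auto
  from LeastI[of "\<lambda>D. 0 < D \<and>
      (\<forall>S. set_mset S \<subseteq> carrier G \<and> size S = D \<longrightarrow> has_weighted_zero_sum G A S)", OF this]
  show "0 < weighted_davenport A G"
    and "\<lbrakk>set_mset S \<subseteq> carrier G; size S = weighted_davenport A G\<rbrakk> \<Longrightarrow> has_weighted_zero_sum G A S"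
    unfolding weighted_davenport_def by blast+
qed

lemma size_less_weighted_davenport:
  assumes "comm_group G" "finite (carrier G)" "A \<noteq> {}"
    and S: "set_mset S \<subseteq> carrier G" "\<not> has_weighted_zero_sum G A S"
  shows "size S < weighted_davenport A G"
proof (rule ccontr)
  assume "\<not> ?thesis"
  then have le: "weighted_davenport A G \<le> size S" by simp
  obtain xs where xs: "mset xs = S"
    using ex_mset by blast
  define T where "T = mset (take (weighted_davenport A G) xs)"
  have "S = T + mset (drop (weighted_davenport A G) xs)"
    unfolding T_def xs[symmetric] by (simp flip: mset_append)
  then have T: "T \<subseteq># S" "size T = weighted_davenport A G"
    using le xs by (auto simp: T_def)
  then have "has_weighted_zero_sum G A T"
    using weighted_davenport_property(2)[OF assms(1-3)] S(1) set_mset_mono[OF T(1)] by blast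
  then show False
    using has_weighted_zero_sum_mono T(1) S(2) by blast
qed

lemma zero_sum_free_of_maximal_size:
  assumes "comm_group G" "finite (carrier G)" "A \<noteq> {}"
  obtains S where "set_mset S \<subseteq> carrier G" "\<not> has_weighted_zero_sum G A S"
    "size S + 1 = weighted_davenport A G"
  \<comment> \<open>The definition ranges over positive lengths only, so the empty sequence is a separate case.\<close>
proof (cases "weighted_davenport A G = 1")
  case True
  then show ?thesis
    using that[of "{#}"] by (simp add: has_weighted_zero_sum_def)
next
  case False
  let ?D = "weighted_davenport A G"
  have D: "0 < ?D - 1" "?D - 1 < ?D"
    using False weighted_davenport_property(1)[OF assms] by auto
  have "\<exists>S. set_mset S \<subseteq> carrier G \<and> size S = ?D - 1 \<and> \<not> has_weighted_zero_sum G A S"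
    using not_less_Least[OF D(2)[unfolded weighted_davenport_def[of A G]]] D(1)
    unfolding weighted_davenport_def by blast
  then show ?thesis using that D by auto
qed

section \<open>Group extensions\<close>

text \<open>
  Map a weighted zero-sum subsequence of \<open>i(S) + T\<close> to \<open>H\<close>.  The terms from \<open>i(S)\<close> become trivial
  while those from \<open>T\<close> do not, since a trivial term would by itself be a zero-sum subsequence of
  \<open>p(T)\<close>.  So the terms from \<open>T\<close> that occur give a zero-sum subsequence of \<open>p(T)\<close>; hence there are
  none, and the subsequence lies in \<open>i(S)\<close>, where injectivity pulls it back to \<open>K\<close>.
\<close>

lemma zero_sum_free_extension:
  assumes groups: "comm_group K" "comm_group G" "comm_group H"
    and i: "i \<in> hom K G" "inj_on i (carrier K)"
    and p: "p \<in> hom G H" "\<And>x. x \<in> carrier K \<Longrightarrow> p (i x) = \<one>\<^bsub>H\<^esub>"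
    and "A \<noteq> {}"
    and S: "set_mset S \<subseteq> carrier K" "\<not> has_weighted_zero_sum K A S"
    and T: "set_mset T \<subseteq> carrier G" "\<not> has_weighted_zero_sum H A (image_mset p T)"
  shows "\<not> has_weighted_zero_sum G A (image_mset i S + T)"
proof
  interpret K: comm_group K by fact
  interpret G: comm_group G by fact
  interpret H: comm_group H by fact
  have iS: "set_mset (image_mset i S) \<subseteq> carrier G"
    using i(1) S(1) by (auto simp: hom_def)
  have pT: "set_mset (image_mset p T) \<subseteq> carrier H"
    using p(1) T(1) by (auto simp: hom_def)
  assume "has_weighted_zero_sum G A (image_mset i S + T)"
  then obtain qs where qs: "qs \<noteq> []" "mset (map fst qs) \<subseteq># image_mset i S + T"
    "snd ` set qs \<subseteq> A" "weighted_prod G qs = \<one>\<^bsub>G\<^esub>"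
    using has_weighted_zero_sum_iff[OF groups(2), of "image_mset i S + T"] iS T(1) by auto
  have carr: "fst ` set qs \<subseteq> carrier G"
    using set_mset_mono[OF qs(2)] iS T(1) by auto
  have T_nontrivial: "p x \<noteq> \<one>\<^bsub>H\<^esub>" if "x \<in># T" for x
  proof
    assume "p x = \<one>\<^bsub>H\<^esub>"
    moreover obtain a where "a \<in> A" using \<open>A \<noteq> {}\<close> by blast
    moreover have "{#p x#} \<subseteq># image_mset p T" using that by simp
    ultimately have "has_weighted_zero_sum H A (image_mset p T)"
      unfolding has_weighted_zero_sum_iff[OF groups(3) pT]
      by (intro exI[of _ "[(p x, a)]"]) simp
    then show False using T(2) by simp
  qed
  define rs where "rs = filter (\<lambda>q. p (fst q) \<noteq> \<one>\<^bsub>H\<^esub>) qs"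
  have "mset (map fst rs) = filter_mset (\<lambda>x. p x \<noteq> \<one>\<^bsub>H\<^esub>) (mset (map fst qs))"
    unfolding rs_def by (induction qs) auto
  also have "\<dots> \<subseteq># filter_mset (\<lambda>x. p x \<noteq> \<one>\<^bsub>H\<^esub>) (image_mset i S + T)"
    using qs(2) by (rule multiset_filter_mono)
  also have "\<dots> = T"
  proof -
    have "filter_mset (\<lambda>x. p x \<noteq> \<one>\<^bsub>H\<^esub>) (image_mset i S) = {#}"
      using p(2) S(1) by (auto simp: filter_mset_eq_mempty_iff)
    moreover have "filter_mset (\<lambda>x. p x \<noteq> \<one>\<^bsub>H\<^esub>) T = T"
      using T_nontrivial by (simp add: filter_mset_eq_conv)
    ultimately show ?thesis by simp
  qed
  finally have rsT: "mset (map fst rs) \<subseteq># T" .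
  have rs_nil: "rs = []"
  proof (rule ccontr)
    assume "rs \<noteq> []"
    let ?ps = "map (map_prod p id) qs"
    let ?rs = "map (map_prod p id) rs"
    have "?rs = filter (\<lambda>q. fst q \<noteq> \<one>\<^bsub>H\<^esub>) ?ps"
      unfolding rs_def by (induction qs) auto
    moreover have "fst ` set ?ps \<subseteq> carrier H"
      using carr p(1) by (force simp: hom_def)
    ultimately have "weighted_prod H ?rs = weighted_prod H ?ps"
      by (simp only:) (rule H.weighted_prod_filter, auto)
    also have "\<dots> = p (weighted_prod G qs)"
      using weighted_prod_hom[OF G.is_group H.is_group p(1) carr] by simp
    also have "\<dots> = \<one>\<^bsub>H\<^esub>"
      using qs(4) hom_one[OF p(1) G.is_group H.is_group] by simp
    finally have "weighted_prod H ?rs = \<one>\<^bsub>H\<^esub>" .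
    moreover have "mset (map fst ?rs) \<subseteq># image_mset p T"
      using image_mset_subseteq_mono[OF rsT, of p] by (simp add: multiset.map_comp comp_def)
    moreover have "snd ` set ?rs \<subseteq> A"
      using qs(3) unfolding rs_def by auto
    ultimately have "has_weighted_zero_sum H A (image_mset p T)"
      unfolding has_weighted_zero_sum_iff[OF groups(3) pT]
      using \<open>rs \<noteq> []\<close> by (intro exI[of _ ?rs]) simp
    then show False using T(2) by simp
  qed
  have "mset (map fst qs) = filter_mset (\<lambda>x. p x = \<one>\<^bsub>H\<^esub>) (mset (map fst qs))"
    using rs_nil unfolding rs_def
    by (intro filter_mset_eq_conv[THEN iffD2, symmetric]) (auto simp: filter_empty_conv)
  also have "\<dots> \<subseteq># filter_mset (\<lambda>x. p x = \<one>\<^bsub>H\<^esub>) (image_mset i S + T)"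
    using qs(2) by (rule multiset_filter_mono)
  also have "\<dots> \<subseteq># image_mset i S"
  proof -
    have "filter_mset (\<lambda>x. p x = \<one>\<^bsub>H\<^esub>) T = {#}"
      using T_nontrivial by simp
    then show ?thesis by (simp del: filter_mset_eq_mempty_iff)
  qed
  finally have qsS: "mset (map fst qs) \<subseteq># image_mset i S" .
  define j where "j = inv_into (carrier K) i"
  define ks where "ks = map (map_prod j id) qs"
  have "image_mset j (image_mset i S) = S"
    using S(1) i(2) by (auto simp: multiset.map_comp j_def subset_iff intro!: multiset.map_ident_strong)
  then have ksS: "mset (map fst ks) \<subseteq># S"
    using image_mset_subseteq_mono[OF qsS, of j]
    by (simp add: ks_def multiset.map_comp comp_def)
  have ks_carr: "fst ` set ks \<subseteq> carrier K"
    using set_mset_mono[OF ksS] S(1) by auto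
  have "i (j (fst q)) = fst q" if "q \<in> set qs" for q
  proof -
    have "fst q \<in># image_mset i S"
      using set_mset_mono[OF qsS] that by auto
    then have "fst q \<in> i ` carrier K" using S(1) by auto
    then show ?thesis unfolding j_def by (rule f_inv_into_f)
  qed
  then have "map (map_prod i id) ks = qs"
    unfolding ks_def by (auto intro!: map_idI simp: prod_eq_iff)
  then have "i (weighted_prod K ks) = i \<one>\<^bsub>K\<^esub>"
    using weighted_prod_hom[OF K.is_group G.is_group i(1) ks_carr] qs(4)
      hom_one[OF i(1) K.is_group G.is_group] by simp
  then have "weighted_prod K ks = \<one>\<^bsub>K\<^esub>"
    using inj_onD[OF i(2)] ks_carr by simp
  moreover have "ks \<noteq> []" "snd ` set ks \<subseteq> A"
    using qs(1,3) unfolding ks_def by auto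
  ultimately have "has_weighted_zero_sum K A S"
    unfolding has_weighted_zero_sum_iff[OF groups(1) S(1)] using ksS by blast
  then show False using S(2) by simp
qed

text \<open>
  Lengths add up when \<open>S\<close> is a longest zero-sum free sequence over \<open>K\<close> and \<open>T\<close> a lift to \<open>G\<close> of a
  longest one over \<open>H\<close>.
\<close>

theorem weighted_davenport_extension:
  assumes groups: "comm_group K" "comm_group G" "comm_group H"
    and fin: "finite (carrier G)"
    and i: "i \<in> hom K G" "inj_on i (carrier K)"
    and p: "p \<in> hom G H" "p ` carrier G = carrier H"
    and triv: "\<And>x. x \<in> carrier K \<Longrightarrow> p (i x) = \<one>\<^bsub>H\<^esub>"
    and "A \<noteq> {}"
  shows "weighted_davenport A K + weighted_davenport A H \<le> weighted_davenport A G + 1"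
proof -
  have "i ` carrier K \<subseteq> carrier G" using i(1) by (auto simp: hom_def)
  then have finK: "finite (carrier K)"
    using i(2) fin by (metis finite_imageD finite_subset)
  have finH: "finite (carrier H)"
    using p(2) fin by (metis finite_imageI)
  obtain S where S: "set_mset S \<subseteq> carrier K" "\<not> has_weighted_zero_sum K A S"
    "size S + 1 = weighted_davenport A K"
    using zero_sum_free_of_maximal_size[OF groups(1) finK \<open>A \<noteq> {}\<close>] .
  obtain U where U: "set_mset U \<subseteq> carrier H" "\<not> has_weighted_zero_sum H A U"
    "size U + 1 = weighted_davenport A H"
    using zero_sum_free_of_maximal_size[OF groups(3) finH \<open>A \<noteq> {}\<close>] .
  define T where "T = image_mset (inv_into (carrier G) p) U"
  have T: "set_mset T \<subseteq> carrier G"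
    using U(1) p(2) by (auto simp: T_def intro!: inv_into_into)
  have pT: "image_mset p T = U"
    using U(1) p(2)
    by (auto simp: T_def multiset.map_comp f_inv_into_f subset_iff intro!: multiset.map_ident_strong)
  have "\<not> has_weighted_zero_sum G A (image_mset i S + T)"
    using zero_sum_free_extension[OF groups i p(1) triv \<open>A \<noteq> {}\<close> S(1,2) T] U(2) pT by simp
  moreover have "set_mset (image_mset i S + T) \<subseteq> carrier G"
    using T S(1) i(1) by (auto simp: hom_def)
  ultimately have "size (image_mset i S + T) < weighted_davenport A G"
    using size_less_weighted_davenport[OF groups(2) fin \<open>A \<noteq> {}\<close>] by blast
  then show ?thesis using S(3) U(3) by (simp add: T_def)
qed

section \<open>Powers of cyclic groups\<close>

lemma comm_group_product_group:
  assumes "\<And>i. i \<in> I \<Longrightarrow> comm_group (G i)"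
  shows "comm_group (product_group I G)"
proof (rule group.group_comm_groupI)
  show "group (product_group I G)"
    using assms by (simp add: comm_group.axioms(2))
  show "x \<otimes>\<^bsub>product_group I G\<^esub> y = y \<otimes>\<^bsub>product_group I G\<^esub> x"
    if "x \<in> carrier (product_group I G)" "y \<in> carrier (product_group I G)" for x y
    using that assms
    by (auto intro!: restrict_ext comm_monoid.m_comm simp: comm_group.axioms(1))
qed

text \<open>
  Each new coordinate is an extension by \<open>C\<^sub>n\<close>: the last coordinate is the quotient, and padding
  with \<open>0\<close> embeds the smaller power as its kernel.
\<close>

lemma weighted_davenport_cyclic_power:
  assumes "n > 0" "A \<noteq> {}"
  shows "k * (weighted_davenport A (integer_mod_group n) - 1) + 1
      \<le> weighted_davenport A (cyclic_power n k)"
proof -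
  have comm: "comm_group (cyclic_power n k)" for k
    by (intro comm_group_product_group) simp
  have fin: "finite (carrier (cyclic_power n k))" for k
    using assms(1) by (auto simp: carrier_integer_mod_group intro!: finite_PiE)
  show ?thesis
  proof (induction k)
    case 0
    then show ?case
      using weighted_davenport_property(1)[OF comm fin assms(2), of 0] by simp
  next
    case (Suc k)
    let ?i = "\<lambda>f. f(k := 0 :: int)"
    let ?p = "\<lambda>f. f k :: int"
    have i: "?i \<in> hom (cyclic_power n k) (cyclic_power n (Suc k))"
      using assms(1)
      by (auto simp: hom_def carrier_integer_mod_group PiE_iff extensional_def fun_eq_iff)
    have inj: "inj_on ?i (carrier (cyclic_power n k))"
      by (rule inj_onI) (auto simp: PiE_iff extensional_def fun_eq_iff, metis less_irrefl)
    have p: "?p \<in> hom (cyclic_power n (Suc k)) (integer_mod_group n)"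
      by (auto simp: hom_def)
    have surj: "?p ` carrier (cyclic_power n (Suc k)) = carrier (integer_mod_group n)"
    proof (intro equalityI subsetI)
      fix x assume "x \<in> carrier (integer_mod_group n)"
      then have "(\<lambda>i\<in>{..<Suc k}. x) \<in> carrier (cyclic_power n (Suc k))" by auto
      then show "x \<in> ?p ` carrier (cyclic_power n (Suc k))"
        by (rule rev_image_eqI) simp
    qed auto
    have "weighted_davenport A (cyclic_power n k) + weighted_davenport A (integer_mod_group n)
        \<le> weighted_davenport A (cyclic_power n (Suc k)) + 1"
      by (rule weighted_davenport_extension[OF comm comm _ fin i inj p surj _ assms(2)]) simp_all
    with Suc weighted_davenport_property(1)[of "integer_mod_group n" A] assms
    show ?case by (simp add: carrier_integer_mod_group)
  qed
qed

lemma weighted_davenport_C2_odd: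
  assumes "A \<noteq> {}" "\<And>a. a \<in> A \<Longrightarrow> odd a"
  shows "2 \<le> weighted_davenport A (integer_mod_group 2)"
proof -
  have carr: "set_mset {#1 :: int#} \<subseteq> carrier (integer_mod_group 2)"
    by simp
  have "\<not> has_weighted_zero_sum (integer_mod_group 2) A {#1#}"
  proof
    assume "has_weighted_zero_sum (integer_mod_group 2) A {#1#}"
    then obtain qs where qs: "qs \<noteq> []" "mset (map fst qs) \<subseteq># {#1#}" "snd ` set qs \<subseteq> A"
      "weighted_prod (integer_mod_group 2) qs = 0"
      using has_weighted_zero_sum_iff[OF abelian_integer_mod_group carr] by auto
    have "length qs \<le> 1"
      using size_mset_mono[OF qs(2)] by simp
    with qs(1) obtain x a where q: "qs = [(x, a)]"
      by (cases qs) auto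
    with qs have "x = 1" "odd a" "a mod 2 = 0"
      using assms(2) by (auto simp: int_pow_integer_mod_group)
    then show False by presburger
  qed
  with carr have "size {#1 :: int#} < weighted_davenport A (integer_mod_group 2)"
    using assms(1)
    by (intro size_less_weighted_davenport) (simp_all add: carrier_integer_mod_group)
  then show ?thesis by simp
qed

text \<open>
  Doubling identifies \<open>C\<^sub>m\<close> with the even residues modulo \<open>2 m\<close>, which form the kernel of
  the parity map onto \<open>C\<^sub>2\<close>.
\<close>

lemma weighted_davenport_double_odd:
  assumes "m > 0" "A \<noteq> {}" "\<And>a. a \<in> A \<Longrightarrow> odd a"
  shows "weighted_davenport A (integer_mod_group m) + 1
      \<le> weighted_davenport A (integer_mod_group (2 * m))"
proof -
  let ?i = "\<lambda>x :: int. 2 * x" and ?p = "\<lambda>x :: int. x mod 2"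
  have i: "?i \<in> hom (integer_mod_group m) (integer_mod_group (2 * m))"
    using assms(1)
    by (auto simp: hom_def carrier_integer_mod_group mult_mod_right distrib_left)
  have inj: "inj_on ?i (carrier (integer_mod_group m))"
    by (auto intro: inj_onI)
  have p: "?p \<in> hom (integer_mod_group (2 * m)) (integer_mod_group 2)"
    using assms(1)
    by (auto simp: hom_def carrier_integer_mod_group mod_mod_cancel mod_add_eq)
  have surj: "?p ` carrier (integer_mod_group (2 * m)) = carrier (integer_mod_group 2)"
  proof (intro equalityI subsetI)
    fix x assume "x \<in> carrier (integer_mod_group 2)"
    then have "x \<in> carrier (integer_mod_group (2 * m))" "x = x mod 2"
      using assms(1) by (auto simp: carrier_integer_mod_group)
    then show "x \<in> ?p ` carrier (integer_mod_group (2 * m))" by blast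
  qed (auto simp: carrier_integer_mod_group)
  have "weighted_davenport A (integer_mod_group m) + weighted_davenport A (integer_mod_group 2)
      \<le> weighted_davenport A (integer_mod_group (2 * m)) + 1"
    by (rule weighted_davenport_extension[OF _ _ _ _ i inj p surj _ assms(2)])
       (use assms(1) in \<open>simp_all add: carrier_integer_mod_group\<close>)
  then show ?thesis
    using weighted_davenport_C2_odd[OF assms(2,3)] by simp
qed

theorem theorem3p2:
  fixes k n n1 n2 :: nat and s :: int
  assumes "k \<ge> 1" and "n \<ge> 8" and "s > 0"
    and "[s ^ 2 = 1] (mod int n)"
    and "\<not> [s = 1] (mod int n)" and "\<not> [s = - 1] (mod int n)"
    and "n = 2 * n1 * n2" and "n1 > 0" and "n2 > 0" and "coprime n1 n2"
    and "[s = - 1] (mod int n1)" and "[s = 1] (mod int n2)"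
    and "(n1 \<ge> 3 \<and> n2 \<ge> 3) \<or>
         (\<exists>t::nat. t \<ge> 3 \<and> n = 2 ^ t \<and> (n1, n2) \<in> {(1, 2 ^ (t - 1)), (2 ^ (t - 1), 1)})"
  shows "weighted_davenport {1, s} (cyclic_power n k)
           \<ge> k * weighted_davenport {1, s} (integer_mod_group (n1 * n2)) + 1"
proof -
  let ?D = "\<lambda>m. weighted_davenport {1, s} (integer_mod_group m)"
  have n: "n = 2 * (n1 * n2)" "n > 0" "n1 * n2 > 0"
    using assms by auto
  have "[s ^ 2 = 1] (mod 2)"
    using assms(4) n(1) by (metis cong_dvd_modulus dvd_triv_left int_ops(7) of_nat_numeral)
  then have "odd s"
    by (auto simp: cong_def elim!: evenE)
  then have "?D (n1 * n2) + 1 \<le> ?D n"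
    using weighted_davenport_double_odd[OF n(3), of "{1, s}"] n(1) by auto
  then have "k * ?D (n1 * n2) + 1 \<le> k * (?D n - 1) + 1"
    by (intro add_right_mono mult_le_mono2) simp
  also have "\<dots> \<le> weighted_davenport {1, s} (cyclic_power n k)"
    using n(2) by (intro weighted_davenport_cyclic_power) simp_all
  finally show ?thesis .
qed

end
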